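(* Let $X$ be a $\mathrm{CAT}(0)$ cube complex. For every vertex $v\in X$ and every $(x,y,z,w)\in\mathscr{A}$, we have $$\mathrm{cr}_v(x,y,z,w)=\#\mathscr{W}(x,z|y,w)-\#\mathscr{W}(x,w|y,z).$$
   Context: A $\mathrm{CAT}(0)$ cube complex is a (nonempty) simply connected cube complex all of whose vertex links are flag simplicial complexes; no finite-dimensionality or local finiteness is assumed. "Points" of $X$ are always vertices ($X$ is identified with its $0$-skeleton). $\mathscr{W}$ and $\mathscr{H}$ are the sets of hyperplanes and halfspaces of $X$; $\mathfrak{h}^*$ is the complement of the halfspace $\mathfrak{h}$, and $\mathfrak{h},\mathfrak{h}^*$ are the two sides of a hyperplane. An ultrafilter is a subset $\sigma\subseteq\mathscr{H}$ such that any two elements of $\sigma$ intersect and, for every hyperplane, a side of it lies in $\sigma$. The Roller compactification $\overline X$ is the set of all ultrafilters; $X$ is embedded in it by $v\mapsto\sigma_v=\{\mathfrak{h}\mid v\in\mathfrak{h}\}$. For $x\in\overline X$ represented by the ultrafilter $\sigma_x$, we say $x$ lies in the halfspace $\mathfrak{h}$ iff $\mathfrak{h}\in\sigma_x$. For $A,B\subseteq\overline X$, $\mathscr{W}(A|B)$ is the set of hyperplanes having a side $\mathfrak{h}$ with $B\subseteq\mathfrak{h}$ and $A\subseteq\mathfrak{h}^*$. For $v\in X$ and $x,y\in\overline X$, the Gromov product is $(x\cdot y)_v=\#\mathscr{W}(v|x,y)\in\mathbb{N}\cup\{+\infty\}$ (all infinite cardinalities are denoted $+\infty$). $\mathscr{A}\subseteq(\overline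 X)^4$ is the set of $(x,y,z,w)$ such that at most one of the three values $(x\cdot y)_v+(z\cdot w)_v$, $(x\cdot z)_v+(y\cdot w)_v$, $(x\cdot w)_v+(y\cdot z)_v$ is infinite; this set does not depend on the choice of $v\in X$. The map $\mathrm{cr}_v\colon\mathscr{A}\to\mathbb{Z}\cup\{\pm\infty\}$ is $$\mathrm{cr}_v(x,y,z,w)=(x\cdot z)_v+(y\cdot w)_v-(x\cdot w)_v-(y\cdot z)_v.$$ *)

theory Defs
  imports "HOL-Analysis.Analysis"
begin

section \<open>Cube complexes\<close>

text \<open>
  A cube complex is given by the family X of the vertex sets of its cubes, of all dimensions
  (vertices are the singletons in X). As in Bridson--Haefliger, cubes are embedded and two cubes
  meet, if at all, in a common face; this entails no loss of generality for CAT(0) cube complexes.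
  Dimensions of cubes are finite but need not be bounded, and no local finiteness is assumed.
\<close>

text \<open>
  A chart identifies the vertices of c with the vertices of [0,1]^n, coded as the subsets of
  {..<n} (the coordinates equal to 1). The faces of [0,1]^n are then the intervals {A..B} of the
  inclusion order; the members of X contained in c must be exactly the faces of c.
\<close>
definition cube_chart :: "'a set set \<Rightarrow> 'a set \<Rightarrow> nat \<Rightarrow> (nat set \<Rightarrow> 'a) \<Rightarrow> bool" where
  "cube_chart X c n \<phi> \<longleftrightarrow>
     bij_betw \<phi> (Pow {..<n}) c \<and>
     {d \<in> X. d \<subseteq> c} = {\<phi> ` {A..B} | A B. A \<subseteq> B \<and> B \<subseteq> {..<n}}"

definition cube_complex :: "'a set set \<Rightarrow> bool" where
  "cube_complex X \<longleftrightarrow>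
     (\<forall>c\<in>X. \<exists>n \<phi>. cube_chart X c n \<phi>) \<and>
     (\<forall>c\<in>X. \<forall>d\<in>X. c \<inter> d = {} \<or> c \<inter> d \<in> X)"

definition vertices :: "'a set set \<Rightarrow> 'a set" where
  "vertices X = \<Union>X"

definition edges :: "'a set set \<Rightarrow> 'a set set" where
  "edges X = {e \<in> X. card e = 2}"

text \<open>
  The point of the cube c with coordinates t in [0,1]^n is recorded as a probability weight on the
  vertices of c, the weight of a vertex being multilinear in t. This embeds the cubes compatibly
  with passing to faces, and injectively. The set below carries the topology of pointwise
  convergence of functions, in which the open stars {p. p v > 0} are open. For finite-dimensional
  X this is the topology of the CAT(0) metric; in general it has the same homotopy type as the CW
  topology, so that simple connectivity is unambiguous.
\<close>
definition realization :: "'a set set \<Rightarrow> ('a \<Rightarrow> real) set" where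
  "realization X =
     {p. \<exists>c\<in>X. \<exists>n \<phi> t. cube_chart X c n \<phi> \<and> (\<forall>i<n. 0 \<le> t i \<and> t i \<le> 1) \<and>
           p = (\<lambda>v. \<Sum>S | S \<subseteq> {..<n} \<and> \<phi> S = v. (\<Prod>i\<in>S. t i) * (\<Prod>i\<in>{..<n} - S. 1 - t i))}"

text \<open>
  Simplices of the link of v are the cubes containing v, each encoded by its set of neighbours
  of v. As cubes meet in faces, distinct cubes at v have distinct sets of neighbours of v.
\<close>
definition link :: "'a set set \<Rightarrow> 'a \<Rightarrow> 'a set set" where
  "link X v = {N. N \<noteq> {} \<and> (\<exists>c\<in>X. v \<in> c \<and> N = {u \<in> c. {u, v} \<in> edges X})}"

definition simplicial_complex :: "'a set set \<Rightarrow> bool" where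
  "simplicial_complex K \<longleftrightarrow>
     (\<forall>N\<in>K. finite N \<and> N \<noteq> {} \<and> (\<forall>M. M \<subseteq> N \<and> M \<noteq> {} \<longrightarrow> M \<in> K))"

definition flag_simplicial_complex :: "'a set set \<Rightarrow> bool" where
  "flag_simplicial_complex K \<longleftrightarrow>
     simplicial_complex K \<and>
     (\<forall>N. finite N \<and> N \<noteq> {} \<and> (\<forall>a\<in>N. \<forall>b\<in>N. {a, b} \<in> K) \<longrightarrow> N \<in> K)"

definition CAT0_cube_complex :: "'a set set \<Rightarrow> bool" where
  "CAT0_cube_complex X \<longleftrightarrow>
     X \<noteq> {} \<and> cube_complex X \<and> simply_connected (realization X) \<and>
     (\<forall>v\<in>vertices X. flag_simplicial_complex (link X v))"


section \<open>Hyperplanes and halfspaces\<close>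

text \<open>
  Two disjoint edges whose union is a cube of X are opposite edges of that cube, a square.
  A hyperplane is identified with the class of the edges it crosses.
\<close>
definition opposite_edges :: "'a set set \<Rightarrow> ('a set \<times> 'a set) set" where
  "opposite_edges X = {(e, f). e \<in> edges X \<and> f \<in> edges X \<and> e \<inter> f = {} \<and> e \<union> f \<in> X}"

definition hyperplanes :: "'a set set \<Rightarrow> 'a set set set" where
  "hyperplanes X = edges X // (opposite_edges X)\<^sup>*"

text \<open>Vertex sets of the connected components of the complement of the hyperplane H.\<close>
definition complement_components :: "'a set set \<Rightarrow> 'a set set \<Rightarrow> 'a set set" where
  "complement_components X H = vertices X // {(u, v). {u, v} \<in> edges X - H}\<^sup>*"

text \<open>
  The sides of H are the two components h and h* of its complement. (A hyperplane of a CAT(0) cube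
  complex always has exactly two complementary components, so both of them are sides.)
\<close>
definition sides :: "'a set set \<Rightarrow> 'a set set \<Rightarrow> 'a set set" where
  "sides X H = {h. complement_components X H = {h, vertices X - h}}"

definition halfspaces :: "'a set set \<Rightarrow> 'a set set" where
  "halfspaces X = (\<Union>H\<in>hyperplanes X. sides X H)"


section \<open>Roller compactification and cross ratio\<close>

definition roller :: "'a set set \<Rightarrow> 'a set set set" where
  "roller X = {\<sigma>. \<sigma> \<subseteq> halfspaces X \<and> (\<forall>h\<in>\<sigma>. \<forall>k\<in>\<sigma>. h \<inter> k \<noteq> {}) \<and>
                  (\<forall>H\<in>hyperplanes X. \<exists>h\<in>sides X H. h \<in> \<sigma>)}"

definition principal :: "'a set set \<Rightarrow> 'a \<Rightarrow> 'a set set" where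
  "principal X v = {h \<in> halfspaces X. v \<in> h}"

text \<open>The hyperplanes separating A from B, where A and B are sets of ultrafilters.\<close>
definition sep :: "'a set set \<Rightarrow> 'a set set set \<Rightarrow> 'a set set set \<Rightarrow> 'a set set set" where
  "sep X A B = {H \<in> hyperplanes X.
     \<exists>h\<in>sides X H. (\<forall>b\<in>B. h \<in> b) \<and> (\<forall>a\<in>A. vertices X - h \<in> a)}"

definition ecard :: "'b set \<Rightarrow> enat" where
  "ecard S = (if finite S then enat (card S) else \<infinity>)"

definition gromov_product :: "'a set set \<Rightarrow> 'a \<Rightarrow> 'a set set \<Rightarrow> 'a set set \<Rightarrow> enat" where
  "gromov_product X v x y = ecard (sep X {principal X v} {x, y})"

definition at_most_one_infinite :: "enat \<Rightarrow> enat \<Rightarrow> enat \<Rightarrow> bool" where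
  "at_most_one_infinite a b c \<longleftrightarrow>
     \<not> (a = \<infinity> \<and> b = \<infinity>) \<and> \<not> (a = \<infinity> \<and> c = \<infinity>) \<and> \<not> (b = \<infinity> \<and> c = \<infinity>)"

text \<open>
  The condition on the three sums does not depend on the vertex v; it is required here for some v.
\<close>
definition cross_ratio_domain ::
  "'a set set \<Rightarrow> ('a set set \<times> 'a set set \<times> 'a set set \<times> 'a set set) set" where
  "cross_ratio_domain X =
     {(x, y, z, w). x \<in> roller X \<and> y \<in> roller X \<and> z \<in> roller X \<and> w \<in> roller X \<and>
        (\<exists>v\<in>vertices X. at_most_one_infinite
           (gromov_product X v x y + gromov_product X v z w)
           (gromov_product X v x z + gromov_product X v y w)
           (gromov_product X v x w + gromov_product X v y z))}"

text \<open>On the domain above, the indeterminate form \<open>\<infinity> - \<infinity>\<close> does not occur.\<close>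
definition cross_ratio ::
  "'a set set \<Rightarrow> 'a \<Rightarrow> 'a set set \<Rightarrow> 'a set set \<Rightarrow> 'a set set \<Rightarrow> 'a set set \<Rightarrow> ereal" where
  "cross_ratio X v x y z w =
     ereal_of_enat (gromov_product X v x z) + ereal_of_enat (gromov_product X v y w)
     - ereal_of_enat (gromov_product X v x w) - ereal_of_enat (gromov_product X v y z)"

end

theory Submission
  imports Defs
begin

text \<open>
  Each of x, y, z, w, v chooses one of the two sides of every hyperplane. Comparing the choices
  shows that W(x,z|y,w) and W(x,w|y,z) are the two differences of the unions
  W(v|x,z) \<open>\<union>\<close> W(v|y,w) and W(v|x,w) \<open>\<union>\<close> W(v|y,z), and that the corresponding intersections agree.
  Counting gives an identity in the extended naturals, and subtracting is legitimate as soon as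
  the two sums of Gromov products at v are not both infinite. The domain guarantees this for some
  vertex only; it passes to v because two vertices are joined by an edge path, the realization
  being connected, and so are separated by finitely many hyperplanes.
\<close>

section \<open>Edge paths between vertices\<close>

definition adjacency :: "'a set set \<Rightarrow> ('a \<times> 'a) set" where
  "adjacency X = {(u, v). {u, v} \<in> edges X}"

lemma sym_adjacency: "sym (adjacency X)"
  by (auto simp: adjacency_def sym_def insert_commute)

text \<open>The coordinates in \<open>S\<close> are switched on one at a time. Each interval
  \<open>{S..insert i S}\<close> is a face with two elements, and injectivity of the chart makes its
  image an edge.\<close>

lemma cube_chart_edge_path:
  assumes chart: "cube_chart X c n \<phi>" and "S \<subseteq> {..<n}"
  shows "(\<phi> {}, \<phi> S) \<in> (adjacency X)\<^sup>*"
proof -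
  have "finite S" using assms(2) finite_subset by blast
  then show ?thesis using assms(2)
  proof (induction S rule: finite_induct)
    case (insert i S)
    have "{S..insert i S} = {S, insert i S}" by auto
    moreover have "\<phi> ` {S..insert i S} \<in> X"
      using chart insert.prems unfolding cube_chart_def by blast
    moreover have "\<phi> S \<noteq> \<phi> (insert i S)"
    proof -
      have "inj_on \<phi> (Pow {..<n})" using chart by (auto simp: cube_chart_def bij_betw_def)
      moreover have "S \<noteq> insert i S" using insert.hyps by blast
      ultimately show ?thesis using insert.prems by (auto dest!: inj_onD)
    qed
    ultimately have "(\<phi> S, \<phi> (insert i S)) \<in> adjacency X"
      by (simp add: adjacency_def edges_def)
    then show ?case using insert by (meson insert_subset rtrancl.rtrancl_into_rtrancl)
  qed simp
qed

lemma cube_edge_path: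
  assumes chart: "cube_chart X c n \<phi>" and "u \<in> c" "v \<in> c"
  shows "(u, v) \<in> (adjacency X)\<^sup>*"
proof -
  have c: "c = \<phi> ` Pow {..<n}" using chart by (auto simp: cube_chart_def bij_betw_def)
  have "(\<phi> {}, u) \<in> (adjacency X)\<^sup>*" "(\<phi> {}, v) \<in> (adjacency X)\<^sup>*"
    using cube_chart_edge_path[OF chart] assms(2,3) c by auto
  then show ?thesis
    using sym_rtrancl[OF sym_adjacency[of X]] by (meson rtrancl_trans symD)
qed

text \<open>The summand of \<open>S\<close> is the probability of drawing \<open>S\<close> when each
  \<open>i < n\<close> is drawn independently with probability \<open>t i\<close>. A vertex not of
  the form \<open>\<phi> S\<close> gets the empty sum 0.\<close>

definition cube_point :: "nat \<Rightarrow> (nat set \<Rightarrow> 'a) \<Rightarrow> (nat \<Rightarrow> real) \<Rightarrow> 'a \<Rightarrow> real" where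
  "cube_point n \<phi> t =
     (\<lambda>v. \<Sum>S | S \<subseteq> {..<n} \<and> \<phi> S = v. (\<Prod>i\<in>S. t i) * (\<Prod>i\<in>{..<n} - S. 1 - t i))"

lemma realization_eq:
  "realization X = {p. \<exists>c\<in>X. \<exists>n \<phi> t. cube_chart X c n \<phi> \<and> (\<forall>i<n. 0 \<le> t i \<and> t i \<le> 1) \<and>
     p = cube_point n \<phi> t}"
  by (simp add: realization_def cube_point_def)

lemma cube_point_pos:
  assumes "\<forall>i<n. 0 \<le> t i \<and> t i \<le> 1" and "S \<subseteq> {..<n}"
    and "\<forall>i\<in>S. 0 < t i" and "\<forall>i\<in>{..<n} - S. t i < 1"
  shows "0 < cube_point n \<phi> t (\<phi> S)"
  unfolding cube_point_def
proof (rule sum_pos2)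
  show "finite {T. T \<subseteq> {..<n} \<and> \<phi> T = \<phi> S}"
    by (rule finite_subset[of _ "Pow {..<n}"]) auto
  show "S \<in> {T. T \<subseteq> {..<n} \<and> \<phi> T = \<phi> S}" using assms(2) by simp
  show "0 < (\<Prod>i\<in>S. t i) * (\<Prod>i\<in>{..<n} - S. 1 - t i)"
    using assms(3,4) by (intro mult_pos_pos prod_pos) auto
  show "0 \<le> (\<Prod>i\<in>T. t i) * (\<Prod>i\<in>{..<n} - T. 1 - t i)"
    if "T \<in> {T. T \<subseteq> {..<n} \<and> \<phi> T = \<phi> S}" for T
    using assms(1) that by (intro mult_nonneg_nonneg prod_nonneg) auto
qed

lemma cube_point_support:
  assumes "cube_chart X c n \<phi>" and "0 < cube_point n \<phi> t v"
  shows "v \<in> c"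
proof (rule ccontr)
  assume "v \<notin> c"
  then have "{S. S \<subseteq> {..<n} \<and> \<phi> S = v} = {}"
    using assms(1) by (auto simp: cube_chart_def bij_betw_def)
  then show False using assms(2) unfolding cube_point_def by (simp only: sum.empty)
qed

text \<open>Both vertices lie in the cube that carries \<open>p\<close>. Hence open stars of
  vertices in different edge-path components do not meet inside the realization.\<close>

lemma realization_support_edge_path:
  assumes "p \<in> realization X" "0 < p u" "0 < p v"
  shows "(u, v) \<in> (adjacency X)\<^sup>*"
  using assms unfolding realization_eq by (auto dest: cube_point_support cube_edge_path)

lemma realization_support_nonempty:
  assumes "p \<in> realization X"
  shows "\<exists>v. 0 < p v"
proof -
  obtain n and \<phi> :: "nat set \<Rightarrow> 'a" and t where
    t: "\<forall>i<n. 0 \<le> t i \<and> t i \<le> 1" and p: "p = cube_point n \<phi> t"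
    using assms unfolding realization_eq by blast
  \<comment> \<open>The witness rounds every positive coordinate up to 1; the remaining coordinates
    are 0, hence below 1.\<close>
  have "0 < p (\<phi> {i. i < n \<and> 0 < t i})"
    unfolding p
  proof (rule cube_point_pos[OF t])
    show "\<forall>i\<in>{..<n} - {i. i < n \<and> 0 < t i}. t i < 1"
      by (auto simp: not_less intro: le_less_trans[OF _ zero_less_one])
  qed auto
  then show ?thesis by blast
qed

lemma vertex_in_realization_support:
  assumes "cube_complex X" "v \<in> vertices X"
  shows "\<exists>p\<in>realization X. 0 < p v"
proof -
  obtain c n \<phi> where c: "c \<in> X" "v \<in> c" "cube_chart X c n \<phi>"
    using assms by (auto simp: cube_complex_def vertices_def)
  then obtain S where S: "S \<subseteq> {..<n}" "v = \<phi> S"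
    by (auto simp: cube_chart_def bij_betw_def)
  \<comment> \<open>These are the coordinates of the corner \<open>v\<close> itself.\<close>
  define t :: "nat \<Rightarrow> real" where "t = indicator S"
  have t: "\<forall>i<n. 0 \<le> t i \<and> t i \<le> 1" by (simp add: t_def indicator_def)
  have "0 < cube_point n \<phi> t (\<phi> S)"
    by (rule cube_point_pos[OF t S(1)]) (auto simp: t_def)
  moreover have "cube_point n \<phi> t \<in> realization X"
    using c t unfolding realization_eq by blast
  ultimately show ?thesis using S(2) by blast
qed

text \<open>
  The library has this only for real normed vector spaces; two constant loops serve as loops here.
\<close>

lemma simply_connected_imp_path_component:
  fixes S :: "'b::topological_space set"
  assumes "simply_connected S" "a \<in> S" "b \<in> S"
  shows "path_component S a b"
proof -
  have loop: "path (\<lambda>_. c)" "pathfinish (\<lambda>_. c) = pathstart (\<lambda>_. c)"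
    "path_image (\<lambda>_. c) \<subseteq> S" if "c \<in> S" for c
    using that by (auto simp: path_def pathstart_def pathfinish_def path_image_def)
  have "homotopic_loops S (\<lambda>_. a) (\<lambda>_. b)"
    using assms(1) loop[OF assms(2)] loop[OF assms(3)] unfolding simply_connected_def by blast
  then show ?thesis
    using homotopic_loops_imp_path_component_value[of S "\<lambda>_. a" "\<lambda>_. b" 0] by simp
qed

lemma simply_connected_imp_connected_topological:
  fixes S :: "'b::topological_space set"
  assumes "simply_connected S"
  shows "connected S"
  using assms by (auto intro!: path_connected_imp_connected
      simp: path_connected_component simply_connected_imp_path_component)

text \<open>The open stars of the vertices in one edge-path component form an open and closed set.\<close>

lemma CAT0_edge_path:
  assumes X: "CAT0_cube_complex X" and u: "u \<in> vertices X" and v: "v \<in> vertices X"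
  shows "(u, v) \<in> (adjacency X)\<^sup>*"
proof (rule ccontr)
  assume uv: "(u, v) \<notin> (adjacency X)\<^sup>*"
  define C where "C = {w. (u, w) \<in> (adjacency X)\<^sup>*}"
  define star where "star w = {p :: 'a \<Rightarrow> real. 0 < p w}" for w
  have cc: "cube_complex X" and conn: "connected (realization X)"
    using X by (auto simp: CAT0_cube_complex_def intro: simply_connected_imp_connected_topological)
  have open_star: "open (star w)" for w
    unfolding star_def by (intro open_Collect_less continuous_intros continuous_on_product_coordinates)
  have "open (\<Union>w\<in>C. star w)" "open (\<Union>w\<in>-C. star w)"
    using open_star by auto
  moreover have "realization X \<subseteq> (\<Union>w\<in>C. star w) \<union> (\<Union>w\<in>-C. star w)"
    using realization_support_nonempty by (fastforce simp: star_def)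
  moreover have "(\<Union>w\<in>C. star w) \<inter> (\<Union>w\<in>-C. star w) \<inter> realization X = {}"
    using realization_support_edge_path[of _ X]
    by (auto simp: star_def C_def) (meson rtrancl_trans)
  moreover have "(\<Union>w\<in>C. star w) \<inter> realization X \<noteq> {}"
    using vertex_in_realization_support[OF cc u] by (auto simp: star_def C_def)
  moreover have "(\<Union>w\<in>-C. star w) \<inter> realization X \<noteq> {}"
    using vertex_in_realization_support[OF cc v] uv by (auto simp: star_def C_def)
  ultimately show False using conn unfolding connected_def by blast
qed


section \<open>Finitely many hyperplanes separate two vertices\<close>

lemma sym_opposite_edges: "sym (opposite_edges X)"
  by (auto simp: sym_def opposite_edges_def Un_commute)

text \<open>By symmetry the closure of \<open>opposite_edges X\<close> is an equivalence, so any
  edge of a class generates it. In particular an edge determines the hyperplane that it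
  crosses.\<close>

lemma hyperplane_eq_class:
  assumes "H \<in> hyperplanes X" "e \<in> H"
  shows "H = (opposite_edges X)\<^sup>* `` {e}"
proof -
  obtain f where H: "H = (opposite_edges X)\<^sup>* `` {f}"
    using assms(1) unfolding hyperplanes_def quotient_def by blast
  then have fe: "(f, e) \<in> (opposite_edges X)\<^sup>*" using assms(2) by simp
  then have ef: "(e, f) \<in> (opposite_edges X)\<^sup>*"
    by (rule symD[OF sym_rtrancl[OF sym_opposite_edges]])
  show ?thesis
    unfolding H using fe ef by (auto intro: rtrancl_trans)
qed

text \<open>A side is a component of the graph left after deleting the edges in \<open>H\<close>, so
  an edge leaving it must be a deleted one.\<close>

lemma sides_crossing_edge:
  assumes h: "h \<in> sides X H" and e: "{u, v} \<in> edges X" and "u \<in> h" "v \<notin> h"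
  shows "{u, v} \<in> H"
proof (rule ccontr)
  assume "{u, v} \<notin> H"
  then have uv: "(u, v) \<in> {(u, v). {u, v} \<in> edges X - H}" using e by simp
  have "h \<in> complement_components X H" using h by (auto simp: sides_def)
  then obtain a where "h = {(u, v). {u, v} \<in> edges X - H}\<^sup>* `` {a}"
    unfolding complement_components_def quotient_def by blast
  then show False using uv assms(3,4) by (auto intro: rtrancl.rtrancl_into_rtrancl)
qed

definition separating :: "'a set set \<Rightarrow> 'a \<Rightarrow> 'a \<Rightarrow> 'a set set set" where
  "separating X u v = {H \<in> hyperplanes X. \<exists>h\<in>sides X H. u \<in> h \<and> v \<notin> h}"

text \<open>Each step of an edge path crosses at most one hyperplane, the class of its edge, so the
  path length bounds the number of separating hyperplanes.\<close>

lemma finite_separating: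
  assumes "(u, v) \<in> (adjacency X)\<^sup>*"
  shows "finite (separating X u v)"
  using assms
proof (induction rule: rtrancl_induct)
  case base
  have "separating X u u = {}" by (auto simp: separating_def)
  then show ?case by simp
next
  case (step v w)
  have "separating X u w \<subseteq> insert ((opposite_edges X)\<^sup>* `` {{v, w}}) (separating X u v)"
  proof
    fix H assume "H \<in> separating X u w"
    then obtain h where H: "H \<in> hyperplanes X" "h \<in> sides X H" "u \<in> h" "w \<notin> h"
      by (auto simp: separating_def)
    show "H \<in> insert ((opposite_edges X)\<^sup>* `` {{v, w}}) (separating X u v)"
    proof (cases "v \<in> h")
      case True
      then have "{v, w} \<in> H"
        using sides_crossing_edge[OF H(2) _ True H(4)] step.hyps by (simp add: adjacency_def)
      then show ?thesis using hyperplane_eq_class[OF H(1)] by blast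
    next
      case False
      then show ?thesis using H by (auto simp: separating_def)
    qed
  qed
  then show ?case using step.IH finite_subset by blast
qed


section \<open>Sides chosen by ultrafilters\<close>

text \<open>This makes taking complements in \<open>vertices X\<close> an involution on
  sides.\<close>

lemma sides_subset_vertices:
  assumes "h \<in> sides X H"
  shows "h \<subseteq> vertices X"
proof
  fix b assume b: "b \<in> h"
  have "h \<in> complement_components X H" using assms by (auto simp: sides_def)
  then obtain a where a: "a \<in> vertices X" "(a, b) \<in> {(u, v). {u, v} \<in> edges X - H}\<^sup>*"
    using b unfolding complement_components_def quotient_def by blast
  show "b \<in> vertices X"
    using a(2,1) by induction (auto simp: edges_def vertices_def)
qed

lemma sides_compl:
  assumes "h \<in> sides X H"
  shows "vertices X - h \<in> sides X H"
proof -
  have "vertices X - (vertices X - h) = h" using sides_subset_vertices[OF assms] by blast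
  then show ?thesis using assms by (auto simp: sides_def)
qed

lemma sides_cases:
  assumes "h \<in> sides X H" "k \<in> sides X H"
  shows "k = h \<or> k = vertices X - h"
  using assms by (auto simp: sides_def doubleton_eq_iff)

text \<open>An ultrafilter contains some side of \<open>H\<close>, and not both, since the two sides
  are disjoint.\<close>

lemma roller_compl_iff:
  assumes \<sigma>: "\<sigma> \<in> roller X" and H: "H \<in> hyperplanes X" and h: "h \<in> sides X H"
  shows "vertices X - h \<in> \<sigma> \<longleftrightarrow> h \<notin> \<sigma>"
proof -
  have "\<forall>h\<in>\<sigma>. \<forall>k\<in>\<sigma>. h \<inter> k \<noteq> {}" using \<sigma> by (simp add: roller_def)
  moreover have "h \<inter> (vertices X - h) = {}" by blast
  moreover obtain k where "k \<in> sides X H" "k \<in> \<sigma>" using \<sigma> H by (auto simp: roller_def)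
  ultimately show ?thesis using sides_cases[OF h] by blast
qed

text \<open>Any given ultrafilter contains a side of every hyperplane, so sides exist;
  \<open>v\<close> lies in that side or in its complement.\<close>

lemma principal_in_roller:
  assumes "roller X \<noteq> {}" and "v \<in> vertices X"
  shows "principal X v \<in> roller X"
proof -
  have "\<exists>k\<in>sides X H. k \<in> principal X v" if H: "H \<in> hyperplanes X" for H
  proof -
    obtain h where h: "h \<in> sides X H" using assms(1) H by (auto simp: roller_def)
    show ?thesis
    proof (cases "v \<in> h")
      case True
      then show ?thesis using h H by (auto simp: principal_def halfspaces_def)
    next
      case False
      then show ?thesis using sides_compl[OF h] H assms(2)
        by (auto simp: principal_def halfspaces_def intro!: bexI[of _ "vertices X - h"])
    qed
  qed
  then show ?thesis by (auto simp: roller_def principal_def)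
qed

text \<open>Once a side \<open>h\<close> is fixed, an ultrafilter matters at \<open>H\<close> only
  through the truth value of \<open>h\<close> belonging to it. Separation becomes a propositional
  condition.\<close>

lemma sep_iff:
  assumes "A \<subseteq> roller X" "B \<subseteq> roller X" and H: "H \<in> hyperplanes X" and h: "h \<in> sides X H"
  shows "H \<in> sep X A B \<longleftrightarrow>
    (\<forall>b\<in>B. h \<in> b) \<and> (\<forall>a\<in>A. h \<notin> a) \<or> (\<forall>b\<in>B. h \<notin> b) \<and> (\<forall>a\<in>A. h \<in> a)"
proof -
  have compl: "vertices X - h \<in> \<sigma> \<longleftrightarrow> h \<notin> \<sigma>" if "\<sigma> \<in> A \<union> B" for \<sigma>
    using roller_compl_iff[OF _ H h] that assms(1,2) by blast
  have "vertices X - (vertices X - h) = h" using sides_subset_vertices[OF h] by blast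
  moreover have "sides X H = {h, vertices X - h}"
    using sides_cases[OF h] sides_compl[OF h] h by blast
  ultimately have "H \<in> sep X A B \<longleftrightarrow>
    (\<forall>b\<in>B. h \<in> b) \<and> (\<forall>a\<in>A. vertices X - h \<in> a) \<or>
    (\<forall>b\<in>B. vertices X - h \<in> b) \<and> (\<forall>a\<in>A. h \<in> a)"
    using H unfolding sep_def by simp
  then show ?thesis using compl by auto
qed

text \<open>If \<open>v\<close> lies in the side \<open>h\<close> that belongs to all of
  \<open>B\<close>, then \<open>h\<close> contains \<open>v\<close> but not \<open>u\<close>;
  otherwise \<open>H\<close> separates \<open>v\<close> from \<open>B\<close> as well.\<close>

lemma sep_subset_change_base:
  assumes R: "roller X \<noteq> {}" and "u \<in> vertices X" "v \<in> vertices X" and "B \<subseteq> roller X"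
  shows "sep X {principal X u} B \<subseteq> sep X {principal X v} B \<union> separating X v u"
proof
  fix H assume H: "H \<in> sep X {principal X u} B"
  then obtain h where h: "H \<in> hyperplanes X" "h \<in> sides X H" "\<forall>b\<in>B. h \<in> b"
    "vertices X - h \<in> principal X u"
    by (auto simp: sep_def)
  show "H \<in> sep X {principal X v} B \<union> separating X v u"
  proof (cases "v \<in> h")
    case True
    then show ?thesis using h by (auto simp: separating_def principal_def)
  next
    case False
    then have "vertices X - h \<in> principal X v"
      using h assms(3) by (auto simp: principal_def)
    then show ?thesis using h by (auto simp: sep_def)
  qed
qed

lemma gromov_product_infinite_change_base:
  assumes X: "CAT0_cube_complex X" and u: "u \<in> vertices X" and v: "v \<in> vertices X"
    and xy: "x \<in> roller X" "y \<in> roller X" and inf: "gromov_product X u x y = \<infinity>"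
  shows "gromov_product X v x y = \<infinity>"
proof -
  have "finite (separating X v u)"
    by (rule finite_separating[OF CAT0_edge_path[OF X v u]])
  moreover have "sep X {principal X u} {x, y} \<subseteq> sep X {principal X v} {x, y} \<union> separating X v u"
    by (rule sep_subset_change_base) (use u v xy in auto)
  ultimately show ?thesis
    using inf finite_subset unfolding gromov_product_def ecard_def by (auto split: if_splits)
qed


section \<open>Counting\<close>

lemma ecard_Un_Int: "ecard A + ecard B = ecard (A \<union> B) + ecard (A \<inter> B)"
  using card_Un_Int[of A B] by (auto simp: ecard_def)

lemma ecard_Un_Diff: "ecard A + ecard (B - A) = ecard (A \<union> B)"
  using ecard_Un_Int[of A "B - A"] by (simp add: ecard_def zero_enat_def[symmetric])

lemma ecard_mono: "A \<subseteq> B \<Longrightarrow> ecard A \<le> ecard B"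
  by (auto simp: ecard_def card_mono finite_subset)

lemma ecard_Un_le: "ecard (A \<union> B) \<le> ecard A + ecard B"
  by (simp add: ecard_Un_Int[of A B])

text \<open>Adding \<open>ecard Q\<close> to the size of the first union, or \<open>ecard P\<close>
  to that of the second, counts the union of all four sets. The common intersection then completes
  inclusion-exclusion on both sides, using sums only, so infinite values are allowed.\<close>

lemma ecard_balance:
  assumes "A \<inter> B = C \<inter> D" and "P = (A \<union> B) - (C \<union> D)" and "Q = (C \<union> D) - (A \<union> B)"
  shows "ecard A + ecard B + ecard Q = ecard C + ecard D + ecard P"
proof -
  have "ecard (A \<union> B) + ecard Q = ecard (C \<union> D) + ecard P"
    using ecard_Un_Diff[of "A \<union> B" "C \<union> D"] ecard_Un_Diff[of "C \<union> D" "A \<union> B"] assms(2,3)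
    by (simp add: Un_commute)
  then show ?thesis
    using ecard_Un_Int[of A B] ecard_Un_Int[of C D] assms(1)
    by (metis add.assoc add.commute)
qed

text \<open>The bounds carry finiteness over: if \<open>c + d\<close> is finite then so is
  \<open>q\<close>, and an infinite \<open>a + b\<close> forces \<open>p\<close> to be infinite; the
  other case is symmetric. Hence both differences take the same infinite value, or all terms are
  finite.\<close>

lemma ereal_of_enat_diff_balance:
  assumes eq: "a + b + q = c + d + p" and "p \<le> a + b" "q \<le> c + d"
    and fin: "\<not> (a + b = \<infinity> \<and> c + d = \<infinity>)"
  shows "ereal_of_enat a + ereal_of_enat b - ereal_of_enat c - ereal_of_enat d =
    ereal_of_enat p - ereal_of_enat q"
proof -
  have "real k + real l + real s = real m + real n + real r" if "k + l + s = m + n + r"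
    for k l s m n r :: nat
    using that by linarith
  then show ?thesis
    using assms
    by (cases a; cases b; cases c; cases d; cases p; cases q) (auto simp: algebra_simps)
qed

theorem proposition3p2:
  fixes X :: "'a set set" and v :: 'a and x y z w :: "'a set set"
  assumes "CAT0_cube_complex X"
    and "v \<in> vertices X"
    and "(x, y, z, w) \<in> cross_ratio_domain X"
  shows "cross_ratio X v x y z w =
           ereal_of_enat (ecard (sep X {x, z} {y, w})) -
           ereal_of_enat (ecard (sep X {x, w} {y, z}))"
proof -
  define A where "A = sep X {principal X v} {x, z}"
  define B where "B = sep X {principal X v} {y, w}"
  define C where "C = sep X {principal X v} {x, w}"
  define D where "D = sep X {principal X v} {y, z}"
  define P where "P = sep X {x, z} {y, w}"
  define Q where "Q = sep X {x, w} {y, z}"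
  note defs = A_def B_def C_def D_def P_def Q_def
  obtain u where R: "x \<in> roller X" "y \<in> roller X" "z \<in> roller X" "w \<in> roller X"
    and u: "u \<in> vertices X" and amo: "at_most_one_infinite
           (gromov_product X u x y + gromov_product X u z w)
           (gromov_product X u x z + gromov_product X u y w)
           (gromov_product X u x w + gromov_product X u y z)"
    using assms(3) by (auto simp: cross_ratio_domain_def)
  have pv: "principal X v \<in> roller X"
    using R(1) assms(2) by (intro principal_in_roller) auto
  have "(H \<in> A \<inter> B \<longleftrightarrow> H \<in> C \<inter> D) \<and> (H \<in> P \<longleftrightarrow> H \<in> (A \<union> B) - (C \<union> D)) \<and>
      (H \<in> Q \<longleftrightarrow> H \<in> (C \<union> D) - (A \<union> B))" for H
  proof (cases "H \<in> hyperplanes X")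
    case True
    \<comment> \<open>With one side fixed, the claim is a tautology in five truth values: whether
      \<open>h\<close> belongs to \<open>x\<close>, \<open>y\<close>, \<open>z\<close>,
      \<open>w\<close> and \<open>principal X v\<close>.\<close>
    obtain h where h: "h \<in> sides X H" using R(1) True by (auto simp: roller_def)
    show ?thesis
      using R pv by (simp add: defs sep_iff[OF _ _ True h]) blast
  next
    case False
    then show ?thesis by (simp add: defs sep_def)
  qed
  then have I: "A \<inter> B = C \<inter> D" and P: "P = (A \<union> B) - (C \<union> D)" and Q: "Q = (C \<union> D) - (A \<union> B)"
    by blast+
  have "ecard P \<le> ecard A + ecard B"
    using ecard_mono[of P "A \<union> B"] P ecard_Un_le[of A B] by auto
  moreover have "ecard Q \<le> ecard C + ecard D"
    using ecard_mono[of Q "C \<union> D"] Q ecard_Un_le[of C D] by auto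
  \<comment> \<open>If both sums were infinite at \<open>v\<close>, each would have an infinite
    summand, which stays infinite at \<open>u\<close>; this contradicts \<open>amo\<close> for its
    last two sums.\<close>
  moreover have "\<not> (ecard A + ecard B = \<infinity> \<and> ecard C + ecard D = \<infinity>)"
    using amo gromov_product_infinite_change_base[OF assms(1,2) u] R
    unfolding at_most_one_infinite_def plus_eq_infty_iff_enat gromov_product_def defs by metis
  ultimately show ?thesis
    unfolding cross_ratio_def gromov_product_def defs[symmetric]
    using ereal_of_enat_diff_balance ecard_balance[OF I P Q] by blast
qed

end
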